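(* Let $G$ be a finite simple graph and let $f : V(G) \to \mathbb{R}$ be a function such that $f(v) \leq 1/(d(v) + 1/2)$ for every $v\in V(G)$ and $\sum_{v\in K} f(v) \leq 1$ for every clique $K\subseteq V(G)$. Then $\alpha(G) \geq \sum_{v\in V(G)} f(v)$.
   Context: $\alpha(G)$ is the independence number of $G$ and $d(v)$ is the degree of $v$ in $G$. *)

theory Defs
  imports Complex_Main "Graph_Theory.Pair_Digraph"
begin

text \<open>
  A finite simple graph is a \<^locale>\<open>pair_graph\<close>: a finite vertex set with a symmetric,
  irreflexive set of ordered pairs of vertices. Each undirected edge occurs once in either
  direction, so the degree of a vertex is its \<^const>\<open>out_degree\<close>.
\<close>

abbreviation degree :: "'a pair_pre_digraph \<Rightarrow> 'a \<Rightarrow> nat" where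
  "degree G v \<equiv> out_degree (with_proj G) v"

definition clique :: "'a pair_pre_digraph \<Rightarrow> 'a set \<Rightarrow> bool" where
  "clique G K \<longleftrightarrow> K \<subseteq> pverts G \<and> (\<forall>u\<in>K. \<forall>v\<in>K. u \<noteq> v \<longrightarrow> (u, v) \<in> parcs G)"

definition independent_set :: "'a pair_pre_digraph \<Rightarrow> 'a set \<Rightarrow> bool" where
  "independent_set G S \<longleftrightarrow> S \<subseteq> pverts G \<and> (\<forall>u\<in>S. \<forall>v\<in>S. (u, v) \<notin> parcs G)"

definition independence_number :: "'a pair_pre_digraph \<Rightarrow> nat" where
  "independence_number G = Max {card S | S. independent_set G S}"

lemma degree_eq_card_neighbours: "degree G v = card {w. (v, w) \<in> parcs G}"
proof -
  have "out_arcs (with_proj G) v = Pair v ` {w. (v, w) \<in> parcs G}"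
    by (auto simp: out_arcs_def)
  then show ?thesis
    by (simp add: out_degree_def card_image inj_on_def)
qed

end

theory Submission
  imports Defs
begin

text \<open>
  Induction on the number of vertices. If an independent set \<open>S\<close> satisfies \<open>f(N[S]) \<le> |S|\<close>, delete
  its closed neighbourhood and put \<open>S\<close> into the independent set of the rest. Otherwise let \<open>v\<close> be
  a vertex of minimum degree \<open>d\<close>; since \<open>f(N[v]) > 1\<close>, it has two nonadjacent neighbours \<open>y\<close>
  and \<open>z\<close>. Fold the graph: replace \<open>N[v]\<close> by a single vertex adjacent to all other
  neighbours of \<open>y\<close> and \<open>z\<close>, with weight \<open>f(N[v]) - 1\<close>. An independent set of the new graph
  gains one vertex in \<open>G\<close>: replace the new vertex by \<open>y\<close> and \<open>z\<close>, or add \<open>v\<close>.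
  The hypotheses on \<open>f\<close> survive, because a clique through the new vertex that violates them
  would contain all but at most \<open>d - 2\<close> vertices of \<open>N(y) \<union> N(z)\<close>, and then \<open>f(N[{y, z}]) \<le> 2\<close>.
\<close>

section \<open>Restricted neighbourhoods and admissible weights\<close>

definition nbhd :: "('a \<times> 'a) set \<Rightarrow> 'a set \<Rightarrow> 'a \<Rightarrow> 'a set" where
  "nbhd E V v = {w \<in> V. (v, w) \<in> E}"

definition complete_on :: "('a \<times> 'a) set \<Rightarrow> 'a set \<Rightarrow> bool" where
  "complete_on E K \<longleftrightarrow> (\<forall>u\<in>K. \<forall>w\<in>K. u \<noteq> w \<longrightarrow> (u, w) \<in> E)"

definition edgeless_on :: "('a \<times> 'a) set \<Rightarrow> 'a set \<Rightarrow> bool" where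
  "edgeless_on E S \<longleftrightarrow> (\<forall>u\<in>S. \<forall>w\<in>S. (u, w) \<notin> E)"

text \<open>Edges of \<open>E\<close> that leave \<open>V\<close> are ignored, so a vertex is deleted by shrinking \<open>V\<close> alone.\<close>

definition admissible :: "('a \<times> 'a) set \<Rightarrow> 'a set \<Rightarrow> ('a \<Rightarrow> real) \<Rightarrow> bool" where
  "admissible E V f \<longleftrightarrow> finite V \<and> sym E \<and> irrefl E \<and>
     (\<forall>v\<in>V. f v \<le> 1 / (real (card (nbhd E V v)) + 1 / 2)) \<and>
     (\<forall>K\<subseteq>V. complete_on E K \<longrightarrow> sum f K \<le> 1)"

lemma nbhd_iff [simp]: "w \<in> nbhd E V v \<longleftrightarrow> w \<in> V \<and> (v, w) \<in> E"
  by (simp add: nbhd_def)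

lemma complete_onD: "complete_on E K \<Longrightarrow> u \<in> K \<Longrightarrow> w \<in> K \<Longrightarrow> w \<noteq> u \<Longrightarrow> (u, w) \<in> E"
  unfolding complete_on_def by metis

lemma finite_nbhd: "finite V \<Longrightarrow> finite (nbhd E V v)"
  by (simp add: nbhd_def)

text \<open>Deleting vertices only lowers degrees, which relaxes the degree bounds, and every clique
  inside \<open>W\<close> is one inside \<open>V\<close>.\<close>

lemma admissible_subset:
  assumes "admissible E V f" "W \<subseteq> V"
  shows "admissible E W f"
proof -
  have fin: "finite V" using assms by (simp add: admissible_def)
  have "f v \<le> 1 / (real (card (nbhd E W v)) + 1 / 2)" if "v \<in> W" for v
  proof -
    have "card (nbhd E W v) \<le> card (nbhd E V v)"
      using assms(2) fin by (intro card_mono finite_nbhd) auto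
    then have "1 / (real (card (nbhd E V v)) + 1 / 2) \<le> 1 / (real (card (nbhd E W v)) + 1 / 2)"
      by (intro divide_left_mono) (auto intro!: mult_pos_pos add_nonneg_pos)
    moreover have "f v \<le> 1 / (real (card (nbhd E V v)) + 1 / 2)"
      using assms that by (auto simp: admissible_def)
    ultimately show ?thesis by linarith
  qed
  then show ?thesis
    using assms finite_subset[OF assms(2) fin] unfolding admissible_def by auto
qed

lemma edgeless_on_Un_delete:
  assumes "sym E" "edgeless_on E S" "edgeless_on E I" "I \<subseteq> V - (S \<union> (\<Union>s\<in>S. nbhd E V s))"
  shows "edgeless_on E (S \<union> I)"
proof -
  have "(s, i) \<notin> E" if "s \<in> S" "i \<in> I" for s i
    using assms(4) that by auto
  then show ?thesis
    using assms(2,3) symD[OF assms(1)] unfolding edgeless_on_def by blast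
qed

section \<open>Two inequalities between reciprocals\<close>

text \<open>Serves the degree bound at the folded vertex, whose weight is at most the left-hand
  side. For \<open>x \<le> y\<close>, the difference \<open>1 / y - 1 / (x + y)\<close> is largest
  at \<open>y = x\<close>, where it is \<open>1 / (2 * x)\<close>.\<close>

lemma inverse_sum_bound_degree:
  fixes a b c :: real
  assumes "0 < c" "c \<le> a" "c \<le> b"
  shows "1 / a + 1 / b - 3 / (2 * c) \<le> 1 / (a + b)"
proof -
  have *: "1 / x + 1 / y - 3 / (2 * c) \<le> 1 / (x + y)" if "c \<le> x" "x \<le> y" for x y
  proof -
    have pos: "0 < x" "0 < y" using assms that by auto
    have "1 / y - 1 / (x + y) = x / (y * (x + y))"
      using pos by (simp add: field_simps)
    also have "\<dots> \<le> x / (x * (2 * x))"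
      using pos that by (intro divide_left_mono mult_mono) auto
    also have "\<dots> = 1 / (2 * x)" using pos by simp
    finally have "1 / x + 1 / y - 1 / (x + y) \<le> 3 / (2 * x)" by simp
    also have "\<dots> \<le> 3 / (2 * c)"
      using assms that by (intro divide_left_mono) auto
    finally show ?thesis by simp
  qed
  show ?thesis
    using *[of a b] *[of b a] assms by (cases "a \<le> b") (auto simp: add.commute)
qed

text \<open>Compares the same bound with the room \<open>1 / (2 * r)\<close> that a clique of
  \<open>r - 1 / 2\<close> vertices will leave below 1. Replacing \<open>a\<close>, \<open>b\<close>
  by \<open>c\<close>, \<open>t\<close> keeps the sum and does not raise the product, since
  \<open>(a - c) * (b - c)\<close> is nonnegative; hence the sum of reciprocals does not
  drop.\<close>

lemma inverse_sum_bound_clique: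
  fixes a b c r :: real
  assumes "0 < c" "c \<le> a" "c \<le> b" "0 < r" "r \<le> a + b - c"
  shows "1 / a + 1 / b - 3 / (2 * c) \<le> 1 / (2 * r)"
proof -
  define t where "t = a + b - c"
  have t: "c \<le> t" "0 < t" using assms by (auto simp: t_def)
  have pos: "0 < a" "0 < b" using assms by auto
  have prod: "c * t \<le> a * b"
  proof -
    have "0 \<le> (a - c) * (b - c)" using assms by simp
    then show ?thesis by (simp add: t_def algebra_simps)
  qed
  have "1 / a + 1 / b = (a + b) / (a * b)" using pos by (simp add: field_simps)
  also have "\<dots> \<le> (a + b) / (c * t)"
    using prod pos t assms by (intro divide_left_mono mult_pos_pos) auto
  also have "\<dots> = 1 / c + 1 / t" using t assms by (simp add: t_def field_simps)
  finally have "1 / a + 1 / b \<le> 1 / c + 1 / t" .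
  moreover have "1 / (2 * t) \<le> 1 / (2 * c)" using t assms by (intro divide_left_mono) auto
  moreover have "1 / (2 * t) \<le> 1 / (2 * r)"
    using t assms by (intro divide_left_mono) (auto simp: t_def)
  ultimately show ?thesis by (simp add: field_simps)
qed

section \<open>Folding a closed neighbourhood\<close>

text \<open>The new vertex of the folded graph reuses the name \<open>y\<close>.\<close>

definition fold_edges :: "('a \<times> 'a) set \<Rightarrow> 'a \<Rightarrow> 'a \<Rightarrow> ('a \<times> 'a) set" where
  "fold_edges E y z = {(a, b) \<in> E. a \<noteq> y \<and> b \<noteq> y}
     \<union> {(a, b). a = y \<and> b \<noteq> y \<and> ((y, b) \<in> E \<or> (z, b) \<in> E)}
     \<union> {(a, b). b = y \<and> a \<noteq> y \<and> ((y, a) \<in> E \<or> (z, a) \<in> E)}"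

lemma edgeless_on_unfold:
  assumes "sym E" "irrefl E" and y: "y \<in> nbhd E V v" and z: "z \<in> nbhd E V v"
    and "y \<noteq> z" and "(y, z) \<notin> E" and "v \<in> V" and "finite V"
    and I: "I \<subseteq> insert y (V - insert v (nbhd E V v))" "edgeless_on (fold_edges E y z) I"
  obtains J where "J \<subseteq> V" "edgeless_on E J" "card J = Suc (card I)"
proof -
  have finI: "finite I" using I(1) \<open>finite V\<close> finite_subset by blast
  have loop: "(a, a) \<notin> E" for a using \<open>irrefl E\<close> by (auto simp: irrefl_def)
  have symE: "(a, b) \<in> E \<longleftrightarrow> (b, a) \<in> E" for a b using symD[OF \<open>sym E\<close>] by blast
  show thesis
  proof (cases "y \<in> I")
    case True
    \<comment> \<open>Here \<open>y\<close> is the folded vertex, so \<open>I\<close> avoids the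
      neighbours of both \<open>y\<close> and \<open>z\<close>. As \<open>y\<close> is in
      \<open>I\<close> already, unfolding amounts to adding \<open>z\<close>.\<close>
    have yi: "(y, a) \<notin> E \<and> (z, a) \<notin> E" if "a \<in> I" for a
    proof (cases "a = y")
      case False
      then show ?thesis using I(2) True that by (auto simp: edgeless_on_def fold_edges_def)
    qed (use loop symE \<open>(y, z) \<notin> E\<close> in auto)
    have "(a, b) \<notin> E" if "a \<in> I" "b \<in> I" for a b
      using I(2) that yi symE by (cases "a = y"; cases "b = y") (auto simp: edgeless_on_def fold_edges_def)
    then have "edgeless_on E (insert z I)"
      using yi loop symE by (auto simp: edgeless_on_def)
    moreover have "z \<notin> I" using I(1) z \<open>y \<noteq> z\<close> by auto
    ultimately show thesis
      using that[of "insert z I"] I(1) y z finI by auto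
  next
    case False
    have "(a, b) \<notin> E" if "a \<in> I" "b \<in> I" for a b
      using I(2) that False by (auto simp: edgeless_on_def fold_edges_def)
    moreover have "(v, a) \<notin> E" if "a \<in> I" for a
      using I(1) that False by auto
    ultimately have "edgeless_on E (insert v I)"
      using loop symE by (auto simp: edgeless_on_def)
    moreover have "v \<notin> I" using I(1) False by auto
    ultimately show thesis
      using that[of "insert v I"] I(1) False \<open>v \<in> V\<close> finI by auto
  qed
qed

text \<open>Minimality of the degree of \<open>v\<close> gives the uniform bound
  \<open>1 / c\<close> on all weights; \<open>big\<close> excludes very large cliques at the folded
  vertex.\<close>

lemma admissible_fold:
  assumes adm: "admissible E V f"
    and v: "v \<in> V" and min: "\<And>u. u \<in> V \<Longrightarrow> card (nbhd E V v) \<le> card (nbhd E V u)"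
    and y: "y \<in> nbhd E V v" and z: "z \<in> nbhd E V v"
    and yz: "y \<noteq> z" "(y, z) \<notin> E"
    and big: "sum f ({y, z} \<union> (nbhd E V y \<union> nbhd E V z)) > 2"
  shows "admissible (fold_edges E y z) (insert y (V - insert v (nbhd E V v)))
           (f(y := sum f (insert v (nbhd E V v)) - 1))"
proof -
  let ?N = "nbhd E V"
  let ?deg = "\<lambda>u. card (?N u)"
  let ?V = "insert y (V - insert v (?N v))"
  let ?E = "fold_edges E y z"
  let ?x = "sum f (insert v (?N v)) - 1"
  \<comment> \<open>\<open>U\<close> is the neighbourhood of the folded vertex. The shifted degrees
    \<open>c\<close>, \<open>a\<close>, \<open>b\<close> turn the degree bounds at \<open>v\<close>,
    \<open>y\<close>, \<open>z\<close> into plain reciprocals.\<close>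
  define U where "U = (?N y \<union> ?N z) - insert v (?N v)"
  define c where "c = real (?deg v) + 1 / 2"
  define a where "a = real (?deg y) + 1 / 2"
  define b where "b = real (?deg z) + 1 / 2"
  have fin: "finite V" and "sym E" and "irrefl E"
    and deg: "\<And>u. u \<in> V \<Longrightarrow> f u \<le> 1 / (real (?deg u) + 1 / 2)"
    and clq: "\<And>K. K \<subseteq> V \<Longrightarrow> complete_on E K \<Longrightarrow> sum f K \<le> 1"
    using adm by (auto simp: admissible_def)
  have finN: "finite (?N u)" for u using fin by (rule finite_nbhd)
  have loop: "(u, u) \<notin> E" for u using \<open>irrefl E\<close> by (auto simp: irrefl_def)
  have symE: "(u, w) \<in> E \<longleftrightarrow> (w, u) \<in> E" for u w using symD[OF \<open>sym E\<close>] by blast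
  have yV: "y \<in> V" "z \<in> V" using y z by auto
  have c0: "0 < c" and ac: "c \<le> a" and bc: "c \<le> b"
    using min[OF yV(1)] min[OF yV(2)] by (auto simp: a_def b_def c_def)
  have deg_c: "f u \<le> 1 / c" if "u \<in> V" for u
  proof -
    have "1 / (real (?deg u) + 1 / 2) \<le> 1 / c"
      using min[OF that] c0 by (intro divide_left_mono) (auto simp: c_def)
    with deg[OF that] show ?thesis by linarith
  qed
  have fy: "f y \<le> 1 / a" and fz: "f z \<le> 1 / b"
    using deg yV by (auto simp: a_def b_def)
  have vN: "v \<notin> ?N v" using loop by simp

  have x_le: "?x \<le> 1 / a + 1 / b - 3 / (2 * c)"
  proof -
    let ?R = "insert v (?N v) - {y, z}"
    have sub: "{y, z} \<subseteq> insert v (?N v)" using y z by auto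
    have "card ?R = card (insert v (?N v)) - card {y, z}"
      using sub by (intro card_Diff_subset) auto
    then have "card ?R = ?deg v - 1" using vN finN yz(1) by simp
    \<comment> \<open>The degree of \<open>v\<close> is at least 2, so the truncated subtraction
      above is exact.\<close>
    moreover have "card {y, z} \<le> ?deg v" using y z finN by (intro card_mono) auto
    ultimately have cR: "real (card ?R) = c - 3 / 2" using yz(1) by (simp add: c_def)
    have "sum f (insert v (?N v)) = sum f ?R + sum f {y, z}"
      using sub finN by (intro sum.subset_diff) auto
    moreover have "sum f ?R \<le> real (card ?R) * (1 / c)"
      using deg_c v by (intro sum_bounded_above) auto
    moreover have "real (card ?R) * (1 / c) = 1 - 3 / (2 * c)"
      unfolding cR using c0 by (simp add: field_simps)
    ultimately show ?thesis using fy fz yz(1) by simp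
  qed

  have card_yz: "card (?N y \<union> ?N z) + 1 \<le> ?deg y + ?deg z"
  proof -
    have "v \<in> ?N y \<inter> ?N z" using y z v symE by auto
    then have "0 < card (?N y \<inter> ?N z)" using finN by (metis card_gt_0_iff empty_iff finite_Int)
    moreover have "?deg y + ?deg z = card (?N y \<union> ?N z) + card (?N y \<inter> ?N z)"
      using finN by (intro card_Un_Int)
    ultimately show ?thesis by linarith
  qed

  have bound: "(f(y := ?x)) u \<le> 1 / (real (card (nbhd ?E ?V u)) + 1 / 2)" if u: "u \<in> ?V" for u
  proof (cases "u = y")
    case True
    have "nbhd ?E ?V y \<subseteq> (?N y \<union> ?N z)" by (auto simp: fold_edges_def)
    then have "card (nbhd ?E ?V y) \<le> card (?N y \<union> ?N z)"
      using finN by (intro card_mono) auto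
    then have "real (card (nbhd ?E ?V y)) + 1 / 2 \<le> a + b"
      using card_yz by (simp add: a_def b_def)
    then have "1 / (a + b) \<le> 1 / (real (card (nbhd ?E ?V y)) + 1 / 2)"
      using c0 ac bc by (intro divide_left_mono) (auto intro!: mult_pos_pos add_nonneg_pos)
    with x_le inverse_sum_bound_degree[OF c0 ac bc] True show ?thesis by simp
  next
    case False
    with u have uV: "u \<in> V" "u \<notin> ?N v" by auto
    \<comment> \<open>The folded vertex is sent to \<open>y\<close> or \<open>z\<close>, whichever
      is adjacent to \<open>u\<close>. Nothing collides, because \<open>z\<close> is absent from the
      folded graph.\<close>
    define g where "g w = (if w = y \<and> (u, y) \<notin> E then z else w)" for w
    have "g ` nbhd ?E ?V u \<subseteq> ?N u"
      using False uV yV symE by (auto simp: g_def fold_edges_def)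
    moreover have "inj_on g (nbhd ?E ?V u)"
    proof (rule inj_onI)
      fix p q
      assume "p \<in> nbhd ?E ?V u" "q \<in> nbhd ?E ?V u" and eq: "g p = g q"
      then have "p \<noteq> z" "q \<noteq> z" using z yz(1) by auto
      then show "p = q" using eq unfolding g_def by metis
    qed
    ultimately have "card (nbhd ?E ?V u) \<le> ?deg u"
      using finN card_inj_on_le by blast
    then have "1 / (real (?deg u) + 1 / 2) \<le> 1 / (real (card (nbhd ?E ?V u)) + 1 / 2)"
      by (intro divide_left_mono) (auto intro!: mult_pos_pos add_nonneg_pos)
    with deg[OF uV(1)] False show ?thesis by simp
  qed

  have new_clique: "sum f Q + ?x \<le> 1" if Q: "Q \<subseteq> U" "complete_on E Q" for Q
  proof -
    have QV: "Q \<subseteq> V" and QN: "Q \<subseteq> ?N y \<union> ?N z" using Q(1) by (auto simp: U_def)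
    have finQ: "finite Q" using QV fin finite_subset by blast
    define r where "r = real (card Q) + 1 / 2"
    have r0: "0 < r" by (simp add: r_def)
    show ?thesis
    \<comment> \<open>With at most \<open>c - 1 / 2\<close> vertices, the uniform bound leaves room
      \<open>1 / (2 * c)\<close>, which is also the bound on \<open>?x\<close> that follows from
      \<open>a, b \<ge> c\<close>.\<close>
    proof (cases "card Q \<le> ?deg v")
      case True
      have "sum f Q \<le> real (card Q) * (1 / c)"
        using deg_c QV by (intro sum_bounded_above) auto
      also have "\<dots> \<le> (c - 1 / 2) * (1 / c)"
        using True c0 by (intro mult_right_mono) (auto simp: c_def)
      also have "\<dots> = 1 - 1 / (2 * c)" using c0 by (simp add: field_simps)
      finally have "sum f Q \<le> 1 - 1 / (2 * c)" .
      moreover have "1 / a \<le> 1 / c" "1 / b \<le> 1 / c"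
        using c0 ac bc by (auto intro!: divide_left_mono)
      moreover have "1 / c + 1 / c - 3 / (2 * c) = 1 / (2 * c)" using c0 by (simp add: field_simps)
      ultimately show ?thesis using x_le by linarith
    next
      case False
      \<comment> \<open>The rest of \<open>Q\<close> together with one of \<open>y\<close>,
        \<open>z\<close> gives \<open>u\<close> at least \<open>card Q\<close> neighbours.\<close>
      have "f u \<le> 1 / r" if u: "u \<in> Q" for u
      proof -
        obtain s where s: "s = y \<or> s = z" "(s, u) \<in> E"
          using QN u unfolding nbhd_def by blast
        have "s \<notin> Q" using s(1) Q(1) y z by (auto simp: U_def)
        have "s \<in> ?N u" using s yV symE[of u s] by auto
        moreover have "w \<in> ?N u" if "w \<in> Q - {u}" for w
        proof -
          have "(u, w) \<in> E" using complete_onD[OF Q(2) u] that by simp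
          then show ?thesis using QV that by auto
        qed
        ultimately have "insert s (Q - {u}) \<subseteq> ?N u" by blast
        then have "card (insert s (Q - {u})) \<le> ?deg u"
          using finN by (intro card_mono) auto
        moreover have "card (insert s (Q - {u})) = card Q"
          using \<open>s \<notin> Q\<close> finQ card_Suc_Diff1[OF finQ u] by (subst card_insert_disjoint) auto
        ultimately have "1 / (real (?deg u) + 1 / 2) \<le> 1 / r"
          using r0 by (intro divide_left_mono) (auto simp: r_def)
        moreover have "f u \<le> 1 / (real (?deg u) + 1 / 2)" using deg QV u by blast
        ultimately show ?thesis by linarith
      qed
      then have "sum f Q \<le> real (card Q) * (1 / r)" by (intro sum_bounded_above)
      also have "\<dots> = 1 - 1 / (2 * r)" using r0 by (simp add: r_def field_simps)
      finally have fQ: "sum f Q \<le> 1 - 1 / (2 * r)" .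
      show ?thesis
      proof (rule ccontr)
        assume "\<not> ?thesis"
        \<comment> \<open>If \<open>r \<le> a + b - c\<close>, then \<open>?x\<close> fits into the
          room \<open>1 / (2 * r)\<close> left by \<open>Q\<close>; a violation therefore forces
          \<open>Q\<close> to be large.\<close>
        then have "\<not> r \<le> a + b - c"
          using inverse_sum_bound_clique[OF c0 ac bc r0] x_le fQ by linarith
        then have large: "?deg y + ?deg z + 1 \<le> card Q + ?deg v"
          by (simp add: a_def b_def c_def r_def)
        \<comment> \<open>A large \<open>Q\<close> leaves at most \<open>?deg v - 2\<close> vertices
          of the two neighbourhoods uncovered, so \<open>?M\<close> has at most
          \<open>?deg v\<close> vertices and weight at most 1. The clique \<open>Q\<close> adds at
          most 1, contradicting \<open>big\<close>.\<close>
        let ?M = "{y, z} \<union> ((?N y \<union> ?N z) - Q)"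
        have "card ?M \<le> card {y, z} + card ((?N y \<union> ?N z) - Q)" by (rule card_Un_le)
        also have "card ((?N y \<union> ?N z) - Q) = card (?N y \<union> ?N z) - card Q"
          using QN finQ by (rule card_Diff_subset[rotated])
        finally have "card ?M \<le> ?deg v"
          using large card_yz yz(1) card_mono[OF _ QN] finN by simp
        have "sum f ?M \<le> real (card ?M) * (1 / c)"
          using deg_c yV by (intro sum_bounded_above) auto
        also have "\<dots> \<le> c * (1 / c)"
          using \<open>card ?M \<le> ?deg v\<close> c0 by (intro mult_right_mono) (auto simp: c_def)
        finally have "sum f ?M \<le> 1" using c0 by simp
        moreover have "sum f Q \<le> 1" using clq QV Q(2) by blast
        moreover have "sum f ({y, z} \<union> (?N y \<union> ?N z)) = sum f ?M + sum f Q"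
        proof -
          have "{y, z} \<union> (?N y \<union> ?N z) = ?M \<union> Q" using QN by auto
          moreover have "?M \<inter> Q = {}" using Q(1) y z by (auto simp: U_def)
          moreover have "finite ?M" using finN by simp
          ultimately show ?thesis using sum.union_disjoint[OF _ finQ] by metis
        qed
        ultimately show False using big by linarith
      qed
    qed
  qed

  \<comment> \<open>Folded edges away from \<open>y\<close> are edges of \<open>E\<close>, so only
    cliques through \<open>y\<close> are new; without \<open>y\<close> they are cliques inside
    \<open>U\<close>.\<close>
  have clique: "sum (f(y := ?x)) K \<le> 1" if K: "K \<subseteq> ?V" "complete_on ?E K" for K
  proof -
    have Q: "complete_on E (K - {y})"
      using K(2) by (auto simp: complete_on_def fold_edges_def)
    have KV: "K - {y} \<subseteq> V" using K(1) by auto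
    have finK: "finite K" using K(1) fin finite_subset by blast
    have eq: "sum (f(y := ?x)) (K - {y}) = sum f (K - {y})" by (intro sum.cong) auto
    show ?thesis
    proof (cases "y \<in> K")
      case True
      have "q \<in> U" if "q \<in> K - {y}" for q
      proof -
        have "(y, q) \<in> ?E" using complete_onD[OF K(2) True] that by simp
        then have "(y, q) \<in> E \<or> (z, q) \<in> E" by (auto simp: fold_edges_def)
        then show ?thesis using K(1) that by (auto simp: U_def)
      qed
      then have "sum f (K - {y}) + ?x \<le> 1" using Q by (intro new_clique) auto
      moreover have "sum (f(y := ?x)) K = ?x + sum (f(y := ?x)) (K - {y})"
        using True finK by (simp add: sum.remove)
      ultimately show ?thesis using eq by linarith
    next
      case False
      then show ?thesis using eq clq[OF KV Q] by simp
    qed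
  qed

  have "sym ?E" using symE by (auto simp: sym_def fold_edges_def)
  moreover have "irrefl ?E" using loop by (auto simp: irrefl_def fold_edges_def)
  ultimately show ?thesis
    using fin bound clique unfolding admissible_def by blast
qed

section \<open>Induction on the number of vertices\<close>

lemma ex_large_edgeless:
  assumes "admissible E V f"
  shows "\<exists>I\<subseteq>V. edgeless_on E I \<and> sum f V \<le> real (card I)"
  using assms
proof (induction "card V" arbitrary: V E f rule: less_induct)
  case less
  let ?N = "nbhd E V"
  have fin: "finite V" and "sym E" and "irrefl E"
    and clq: "\<And>K. K \<subseteq> V \<Longrightarrow> complete_on E K \<Longrightarrow> sum f K \<le> 1"
    using less.prems by (auto simp: admissible_def)
  have loop: "(u, u) \<notin> E" for u using \<open>irrefl E\<close> by (auto simp: irrefl_def)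
  have symE: "(u, w) \<in> E \<longleftrightarrow> (w, u) \<in> E" for u w using symD[OF \<open>sym E\<close>] by blast
  have delete: ?case
    if S: "S \<subseteq> V" "S \<noteq> {}" "edgeless_on E S" "sum f (S \<union> (\<Union>s\<in>S. ?N s)) \<le> real (card S)" for S
  proof -
    let ?D = "S \<union> (\<Union>s\<in>S. ?N s)"
    have D: "?D \<subseteq> V" using S(1) by auto
    have smaller: "card (V - ?D) < card V" using S(1,2) fin by (intro psubset_card_mono) auto
    have "admissible E (V - ?D) f" using less.prems by (rule admissible_subset) auto
    from less.hyps[OF smaller this]
    obtain I where I: "I \<subseteq> V - ?D" "edgeless_on E I" "sum f (V - ?D) \<le> real (card I)"
      by blast
    have "edgeless_on E (S \<union> I)" using \<open>sym E\<close> S(3) I(2,1) by (rule edgeless_on_Un_delete)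
    moreover have "sum f V \<le> real (card (S \<union> I))"
    proof -
      have "finite S" "finite I" using S(1) I(1) fin by (auto intro: finite_subset)
      moreover have "S \<inter> I = {}" using I(1) by auto
      ultimately have "card (S \<union> I) = card S + card I" by (rule card_Un_disjoint)
      moreover have "sum f V = sum f (V - ?D) + sum f ?D" using D fin by (rule sum.subset_diff)
      ultimately show ?thesis using S(4) I(3) by simp
    qed
    moreover have "S \<union> I \<subseteq> V" using S(1) I(1) by auto
    ultimately show ?case by blast
  qed
  show ?case
  proof (cases "V = {}")
    case True
    then show ?thesis by (auto simp: edgeless_on_def)
  next
    case False
    obtain v where v: "v \<in> V" and min: "\<And>u. u \<in> V \<Longrightarrow> card (?N v) \<le> card (?N u)"
      using arg_min_if_finite[OF fin False, of "\<lambda>u. card (?N u)"] by (metis leI)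
    show ?thesis
    \<comment> \<open>The split is on completeness of the closed neighbourhood rather than on its
      weight. The weight \<open>?x\<close> of the folded vertex may thus be negative, which
      admissibility permits.\<close>
    proof (cases "complete_on E (insert v (?N v))")
      case True
      have "sum f (insert v (?N v)) \<le> 1" using v by (intro clq True) auto
      then show ?thesis using delete[of "{v}"] v loop by (simp add: edgeless_on_def)
    next
      case False
      then obtain y z where mem: "y \<in> insert v (?N v)" "z \<in> insert v (?N v)"
        and yz: "y \<noteq> z" "(y, z) \<notin> E"
        unfolding complete_on_def by blast
      \<comment> \<open>Since \<open>v\<close> is adjacent to all other members of its closed
        neighbourhood, neither end of a nonadjacent pair is \<open>v\<close>.\<close>
      have y: "y \<in> ?N v" using mem yz by auto
      have z: "z \<in> ?N v" using mem yz symE[of y v] by auto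
      show ?thesis
      proof (cases "sum f ({y, z} \<union> (?N y \<union> ?N z)) \<le> 2")
        case True
        moreover have "edgeless_on E {y, z}" using yz loop symE by (auto simp: edgeless_on_def)
        ultimately show ?thesis using delete[of "{y, z}"] y z yz(1) by simp
      next
        case False
        let ?R = "V - insert v (?N v)"
        let ?x = "sum f (insert v (?N v)) - 1"
        have adm: "admissible (fold_edges E y z) (insert y ?R) (f(y := ?x))"
          using less.prems v min y z yz False by (intro admissible_fold) auto
        have "card (insert y ?R) < card V"
        proof -
          have "v \<notin> insert y ?R" using y loop by auto
          moreover have "insert y ?R \<subseteq> V" using y by auto
          ultimately show ?thesis using fin v by (intro psubset_card_mono) auto
        qed
        from less.hyps[OF this adm] obtain I where I: "I \<subseteq> insert y ?R" "edgeless_on (fold_edges E y z) I"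
          "sum (f(y := ?x)) (insert y ?R) \<le> real (card I)"
          by blast
        obtain J where J: "J \<subseteq> V" "edgeless_on E J" "card J = Suc (card I)"
          using edgeless_on_unfold[OF \<open>sym E\<close> \<open>irrefl E\<close> y z yz v fin I(1,2)] by blast
        \<comment> \<open>Folding lowers the total weight by exactly 1, matching the one vertex that
          \<open>J\<close> gains over \<open>I\<close>.\<close>
        have "sum (f(y := ?x)) ?R = sum f ?R" using y by (intro sum.cong) auto
        then have "sum (f(y := ?x)) (insert y ?R) = ?x + sum f ?R" using fin y by simp
        moreover have "sum f V = sum f ?R + sum f (insert v (?N v))"
          using v fin by (intro sum.subset_diff) auto
        ultimately have "sum f V \<le> real (card J)" using I(3) J(3) by simp
        with J show ?thesis by blast
      qed
    qed
  qed
qed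

section \<open>Transfer to \<open>pair_graph\<close>\<close>

theorem theorem1p4:
  fixes G :: "'a pair_pre_digraph" and f :: "'a \<Rightarrow> real"
  assumes "pair_graph G"
    and "\<And>v. v \<in> pverts G \<Longrightarrow> f v \<le> 1 / (real (degree G v) + 1 / 2)"
    and "\<And>K. clique G K \<Longrightarrow> (\<Sum>v\<in>K. f v) \<le> 1"
  shows "real (independence_number G) \<ge> (\<Sum>v\<in>pverts G. f v)"
proof -
  interpret pair_graph G by (rule assms(1))
  \<comment> \<open>Arcs end in vertices of \<open>G\<close>, so restricting to
    \<open>pverts G\<close> loses no neighbour and the cardinality is the degree.\<close>
  have nbhd: "nbhd (parcs G) (pverts G) v = {w. (v, w) \<in> parcs G}" for v
    using in_arcsD2 by (auto simp: nbhd_def)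
  have "sym (parcs G)" using arcs_symmetric by (auto intro: symI)
  moreover have "irrefl (parcs G)" using no_loops' by (auto simp: irrefl_def)
  ultimately have "admissible (parcs G) (pverts G) f"
    using assms(2,3) finite_verts unfolding admissible_def
    by (simp add: nbhd degree_eq_card_neighbours clique_def complete_on_def)
  then obtain I where I: "I \<subseteq> pverts G" "edgeless_on (parcs G) I"
    "sum f (pverts G) \<le> real (card I)"
    using ex_large_edgeless by blast
  have "{card S | S. independent_set G S} \<subseteq> card ` Pow (pverts G)"
    by (auto simp: independent_set_def)
  then have "finite {card S | S. independent_set G S}"
    by (rule finite_subset) simp
  moreover have "independent_set G I"
    using I(1,2) by (auto simp: independent_set_def edgeless_on_def)
  ultimately have "card I \<le> independence_number G"
    unfolding independence_number_def by (intro Max_ge) auto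
  then show ?thesis using I(3) by linarith
qed

end
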